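(* For each consecutive pattern $\tau$ of length two or three listed below, $F_\tau(x;q)$ is given by the stated formula, and $\mathrm{tot}_n(\tau)$ is given by the stated formula for all $n\geq 2$. (1) $\tau=11$: $F_\tau(x;q)=\dfrac{x(1-(1+q)x)}{1-2(1+q)x+q(2+q)x^2}$, $\quad\mathrm{tot}_n(\tau)=\dfrac{(n-1)(3^{n-2}+1)}{2}$. (2) $\tau=12$: $F_\tau(x;q)=\dfrac{x(1-(1+q)x)}{1-2(1+q)x+(1+q+q^2)x^2}$, $\quad\mathrm{tot}_n(\tau)=\dfrac{(n-1)(3^{n-1}+1)}{4}$. (3) $\tau=21$: $F_\tau(x;q)=\dfrac{x(1-2x)}{1-4x+(4-q)x^2}$, $\quad\mathrm{tot}_n(\tau)=\dfrac{(n-1)(3^{n-2}-1)}{4}$. (4) $\tau=111$: $F_\tau(x;q)=\dfrac{x(1+(1-q)x)(1-(1+q)x-(1-q)x^2)}{1-2(1+q)x-(2-4q-q^2)x^2+2q(1-q)x^3}$, $\quad\mathrm{tot}_n(\tau)=\mathrm{tot}_{n-1}(11)$. (5) $\tau\in\{112,122\}$: $F_\tau(x;q)=\dfrac{x(1-2x+(1-q)x^2)}{1-4x+(5-2q)x^2-3(1-q)x^3+(1-q)^2x^4}$, $\quad\mathrm{tot}_n(\tau)=\mathrm{tot}_{n-1}(12)$. (6) $\tau=121$: $F_\tau(x;q)=\dfrac{x(1-2x)}{1-4x+(4-q)x^2-2(1-q)x^3}$, $\quad\mathrm{tot}_n(\tau)=\dfrac{(n+1)3^{n-3}+n-3}{4}$.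 (7) $\tau=123$: $F_\tau(x;q)=\dfrac{x(1+(1-q)x)(1-(1+q)x-(1-q)x^2)}{1-2(1+q)x-(2-4q-q^2)x^2+2(1-q^2)x^3+(1-q)^2x^4}$, $\quad\mathrm{tot}_n(\tau)=(n-2)3^{n-3}$. (8) $\tau\in\{211,221,231\}$: $F_\tau(x;q)=\dfrac{x(1-2x)}{1-4x+3x^2+(1-q)x^3}$, $\quad\mathrm{tot}_n(\tau)=\mathrm{tot}_{n-1}(21)$. (9) $\tau=212$: $F_\tau(x;q)=\dfrac{x(1-3x+(3-q)x^2-2(1-q)x^3)}{(1-x)(1-4x+(4-q)x^2-2(1-q)x^3)}$, $\quad\mathrm{tot}_n(\tau)=\mathrm{tot}_{n-1}(21)$. (10) $\tau=312$: $F_\tau(x;q)=\dfrac{x(1-3x+2x^2+(1-q)x^3)}{(1-x)(1-4x+3x^2+(1-q)x^3)}$, $\quad\mathrm{tot}_n(\tau)=\dfrac{(n-5)3^{n-3}+n-1}{4}$.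
   Context: A Catalan word of length $n\geq 1$ is an integer sequence $\pi=\pi_1\cdots\pi_n$ with $\pi_1=1$ and $1\leq \pi_{i+1}\leq \pi_i+1$ for $1\leq i\leq n-1$. A (weakly) increasing run of a word is a maximal nondecreasing string of consecutive letters. A Catalan word is flattened if the sequence of first letters of its increasing runs, read from left to right, is nondecreasing. $\mathcal{F}_n$ is the set of flattened Catalan words of length $n$. For a pattern $\tau=\tau_1\cdots\tau_m$, $\#\tau(\pi)$ is the number of occurrences of $\tau$ in $\pi$ as a consecutive (subword) pattern, i.e., the number of indices $i$ such that $\pi_i\pi_{i+1}\cdots\pi_{i+m-1}$ is order-isomorphic to $\tau$. The generating function $F_\tau(x;q)$ is the formal power series $F_\tau(x;q)=\sum_{n\geq1}\left(\sum_{\pi\in\mathcal{F}_n}q^{\#\tau(\pi)}\right)x^n$, and $\mathrm{tot}_n(\tau)=\sum_{\pi\in\mathcal{F}_n}\#\tau(\pi)$ for $n\geq 1$ is the total number of occurrences of $\tau$ in all the members of $\mathcal{F}_n$. *)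

theory Defs
  imports
    Complex_Main
    "HOL-Computational_Algebra.Formal_Power_Series"
    "HOL-Computational_Algebra.Fraction_Field"
    "HOL-Computational_Algebra.Polynomial"
begin

definition catalan_word :: "nat list \<Rightarrow> bool" where
  "catalan_word w \<longleftrightarrow> w \<noteq> [] \<and> w ! 0 = 1 \<and>
     (\<forall>i. Suc i < length w \<longrightarrow> 1 \<le> w ! Suc i \<and> w ! Suc i \<le> w ! i + 1)"

definition nondecreasing_string :: "nat list \<Rightarrow> nat \<Rightarrow> nat \<Rightarrow> bool" where
  "nondecreasing_string w i j \<longleftrightarrow>
     i \<le> j \<and> j < length w \<and> sorted (take (Suc j - i) (drop i w))"

text \<open>Runs are recorded by the (0-based) positions of their first and last letters.\<close>

definition increasing_run :: "nat list \<Rightarrow> nat \<Rightarrow> nat \<Rightarrow> bool" where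
  "increasing_run w i j \<longleftrightarrow> nondecreasing_string w i j \<and>
     (\<forall>i' j'. nondecreasing_string w i' j' \<and> i' \<le> i \<and> j \<le> j' \<longrightarrow> i' = i \<and> j' = j)"

definition run_first_letters :: "nat list \<Rightarrow> nat list" where
  "run_first_letters w =
     map (\<lambda>i. w ! i) (filter (\<lambda>i. \<exists>j. increasing_run w i j) [0..<length w])"

definition flattened :: "nat list \<Rightarrow> bool" where
  "flattened w \<longleftrightarrow> sorted (run_first_letters w)"

definition flat_catalan :: "nat \<Rightarrow> nat list set" where
  "flat_catalan n = {w. length w = n \<and> catalan_word w \<and> flattened w}"

definition order_isomorphic :: "nat list \<Rightarrow> nat list \<Rightarrow> bool" where
  "order_isomorphic u v \<longleftrightarrow> length u = length v \<and>
     (\<forall>i < length u. \<forall>j < length u. u ! i < u ! j \<longleftrightarrow> v ! i < v ! j)"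

definition occurrences :: "nat list \<Rightarrow> nat list \<Rightarrow> nat" where
  "occurrences t w =
     card {i. i + length t \<le> length w \<and>
              order_isomorphic (take (length t) (drop i w)) t}"

definition tot :: "nat \<Rightarrow> nat list \<Rightarrow> nat" where
  "tot n t = (\<Sum>w\<in>flat_catalan n. occurrences t w)"

text \<open>The variable \<open>q\<close> is an indeterminate. The coefficients in \<open>x\<close> of the generating function
  lie in \<open>\<int>[q]\<close>; they are embedded in its field of fractions \<open>\<rat>(q)\<close> so that quotients of
  power series in \<open>x\<close> are available.\<close>

definition q_var :: "int poly fract" where
  "q_var = Fract [:0, 1:] 1"

definition flat_gf :: "nat list \<Rightarrow> int poly fract fps" where
  "flat_gf t =
     Abs_fps (\<lambda>n. if n \<ge> 1 then \<Sum>w\<in>flat_catalan n. q_var ^ occurrences t w else 0)"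

text \<open>The sums above range over finite sets.\<close>

lemma finite_flat_catalan: "finite (flat_catalan n)"
proof (rule finite_subset)
  show "flat_catalan n \<subseteq> {w. set w \<subseteq> {..n} \<and> length w = n}"
  proof
    fix w assume "w \<in> flat_catalan n"
    then have len: "length w = n" and cat: "catalan_word w"
      by (simp_all add: flat_catalan_def)
    have bound: "w ! i \<le> Suc i" if "i < n" for i
      using that
    proof (induction i)
      case 0
      then show ?case using cat by (simp add: catalan_word_def)
    next
      case (Suc i)
      then have "w ! Suc i \<le> w ! i + 1"
        using cat len by (simp add: catalan_word_def)
      then show ?case using Suc by simp
    qed
    have "set w \<subseteq> {..n}"
    proof
      fix a assume "a \<in> set w"
      then obtain i where "i < n" "a = w ! i"
        using len by (auto simp: in_set_conv_nth)
      then show "a \<in> {..n}" using bound[of i] by simp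
    qed
    then show "w \<in> {w. set w \<subseteq> {..n} \<and> length w = n}"
      using len by simp
  qed
  show "finite {w. set w \<subseteq> {..n} \<and> length w = n}"
    by (rule finite_lists_length_eq) simp
qed

end

theory Submission
  imports Defs
begin

text \<open>
  A Catalan word climbs by at most one at each step, so a flattened word can be read from left to
  right while remembering only the first letter \<open>m\<close> of the current run and the current letter \<open>h\<close>.
  The next letter is \<open>h\<close>, or \<open>h + 1\<close>, or, opening a new run, any \<open>y\<close> with \<open>m \<le> y < h\<close>. Up to
  translation the future depends only on the height \<open>d = h - m\<close>: a step keeps \<open>d\<close>, raises it by
  one, or resets it to \<open>0\<close> in one of \<open>d\<close> ways (\<open>sum_continuations_step\<close>). Whether a consecutive
  pattern occurs is decided by the last one or two steps, once the falls by exactly one are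
  distinguished from the deeper falls (\<open>encodes_pairs\<close>, \<open>encodes_triples\<close>).

  The height is unbounded, but the number of ways to fall is linear in \<open>d\<close>. Hence the weighted
  count of the continuations of a prefix is an affine function of \<open>d\<close> for \<open>d \<ge> 1\<close>
  (\<open>weight_second_difference\<close>). The infinite system of equations between the generating functions
  for the various heights therefore closes up at the heights \<open>0\<close>, \<open>1\<close>, \<open>2\<close> (\<open>series_system\<close>), and
  for each pattern the stated rational function results from eliminating the unknowns of this
  finite linear system.

  For the totals, an occurrence is charged to the moment at which its first step is made. The total
  then satisfies the same recursion in \<open>d\<close> with an inhomogeneous term, which counts the words that
  start with the pattern (\<open>accumulated\<close>, \<open>tot_pair_patterns\<close>, \<open>tot_triple_patterns\<close>). For
  most patterns of length three this term is that of a pattern of length two applied to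
  words shorter by one letter, whence most of the identities between totals. Everything else follows by
  solving the recursion in closed form, again by functions affine in \<open>d\<close> for \<open>d \<ge> 1\<close>.
\<close>

section \<open>Flattened words as admissible continuations\<close>

text \<open>The two kinds of descent, by exactly one and by more than one, must be told apart because
  this is what distinguishes 121 from 231 and 212 from 312.\<close>

datatype step = Level | Rise | Dip | Plunge

definition step_of :: "nat \<Rightarrow> nat \<Rightarrow> step" where
  "step_of g h = (if h = g then Level else if g < h then Rise else if Suc h = g then Dip else Plunge)"

text \<open>In \<open>continues m h v\<close> the letters \<open>v\<close> are appended to a word whose last letter is \<open>h\<close> and whose
  last run starts with \<open>m\<close>. A descent to \<open>y\<close> starts a run, so \<open>y\<close> becomes the new bound.\<close>

fun continues :: "nat \<Rightarrow> nat \<Rightarrow> nat list \<Rightarrow> bool" where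
  "continues m h [] \<longleftrightarrow> True"
| "continues m h (y # v) \<longleftrightarrow>
     y \<le> Suc h \<and> (if h \<le> y then continues m y v else m \<le> y \<and> continues y y v)"

definition continuations :: "nat \<Rightarrow> nat \<Rightarrow> nat \<Rightarrow> nat list set" where
  "continuations n m h = {v. length v = n \<and> continues m h v}"

fun later_run_heads :: "nat \<Rightarrow> nat list \<Rightarrow> nat list" where
  "later_run_heads h [] = []"
| "later_run_heads h (y # v) = (if y < h then y # later_run_heads y v else later_run_heads y v)"

text \<open>Sortedness is expressed through adjacent letters, so that extending a string by one position to
  either side is a local condition.\<close>

lemma nondecreasing_string_iff:
  "nondecreasing_string w i j \<longleftrightarrow>
     i \<le> j \<and> j < length w \<and> (\<forall>k. i \<le> k \<and> k < j \<longrightarrow> w ! k \<le> w ! Suc k)"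
proof (cases "i \<le> j \<and> j < length w")
  case True
  have "sorted (take (Suc j - i) (drop i w)) \<longleftrightarrow>
      (\<forall>k. Suc k < Suc j - i \<longrightarrow> w ! (i + k) \<le> w ! Suc (i + k))"
    using True by (auto simp: sorted_iff_nth_Suc)
  also have "\<dots> \<longleftrightarrow> (\<forall>k. i \<le> k \<and> k < j \<longrightarrow> w ! k \<le> w ! Suc k)"
  proof safe
    fix k assume *: "\<forall>k. Suc k < Suc j - i \<longrightarrow> w ! (i + k) \<le> w ! Suc (i + k)" "i \<le> k" "k < j"
    show "w ! k \<le> w ! Suc k" using *(1)[rule_format, of "k - i"] *(2,3) by simp
  qed auto
  finally show ?thesis using True by (simp add: nondecreasing_string_def)
qed (auto simp: nondecreasing_string_def)

text \<open>A string can be extended to the left of \<open>i\<close> exactly if there is no descent into \<open>i\<close>, and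
  extending it to the right as far as possible does not affect this.\<close>

lemma ex_increasing_run_iff:
  "(\<exists>j. increasing_run w i j) \<longleftrightarrow> i < length w \<and> (i = 0 \<or> w ! i < w ! (i - 1))"
proof
  assume "\<exists>j. increasing_run w i j"
  then obtain j where run: "nondecreasing_string w i j"
    and max: "\<And>i' j'. nondecreasing_string w i' j' \<Longrightarrow> i' \<le> i \<Longrightarrow> j \<le> j' \<Longrightarrow> i' = i"
    unfolding increasing_run_def by blast
  have "w ! i < w ! (i - 1)" if "i \<noteq> 0"
  proof (rule ccontr)
    assume no_fall: "\<not> w ! i < w ! (i - 1)"
    obtain g where g: "i = Suc g" using \<open>i \<noteq> 0\<close> by (cases i) auto
    have "w ! k \<le> w ! Suc k" if "g \<le> k" "k < j" for k
      using run no_fall that g by (cases "k = g") (auto simp: nondecreasing_string_iff)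
    then have "nondecreasing_string w g j"
      using run g by (auto simp: nondecreasing_string_iff)
    from max[OF this] g show False by simp
  qed
  then show "i < length w \<and> (i = 0 \<or> w ! i < w ! (i - 1))"
    using run by (auto simp: nondecreasing_string_iff)
next
  assume i: "i < length w \<and> (i = 0 \<or> w ! i < w ! (i - 1))"
  define j where "j = Max {j. nondecreasing_string w i j}"
  have fin: "finite {j. nondecreasing_string w i j}"
    by (rule finite_subset[of _ "{..<length w}"]) (auto simp: nondecreasing_string_iff)
  have "nondecreasing_string w i i"
    using i by (auto simp: nondecreasing_string_iff)
  then have run: "nondecreasing_string w i j" and max: "\<And>j'. nondecreasing_string w i j' \<Longrightarrow> j' \<le> j"
    using Max_in[OF fin] Max_ge[OF fin] unfolding j_def by auto
  have "i' = i \<and> j' = j" if *: "nondecreasing_string w i' j'" "i' \<le> i" "j \<le> j'" for i' j'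
  proof -
    have "\<not> i' < i"
    proof
      assume "i' < i"
      then obtain g where "i = Suc g" "i' \<le> g" by (cases i) auto
      then show False
        using * run i by (auto simp: nondecreasing_string_iff)
    qed
    then have "i' = i" using * by simp
    moreover have "j' = j" using max[of j'] * \<open>i' = i\<close> by simp
    ultimately show ?thesis by simp
  qed
  then show "\<exists>j. increasing_run w i j"
    using run unfolding increasing_run_def by blast
qed

lemma run_first_letters_Cons: "run_first_letters (h # v) = h # later_run_heads h v"
proof (induction v rule: rev_induct)
  case Nil
  show ?case by (simp add: run_first_letters_def ex_increasing_run_iff)
next
  case (snoc y v)
  have heads: "later_run_heads h (v @ [y]) =
      later_run_heads h v @ (if y < last (h # v) then [y] else [])"
    by (induction v arbitrary: h) auto
  have step: "run_first_letters (u @ [y]) = run_first_letters u @ (if y < last u then [y] else [])"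
    if "u \<noteq> []" for u
  proof -
    have "map ((!) (u @ [y])) (filter (\<lambda>i. \<exists>j. increasing_run (u @ [y]) i j) [0..<length u]) =
        run_first_letters u"
      unfolding run_first_letters_def
      by (rule map_cong[OF filter_cong]) (auto simp: ex_increasing_run_iff nth_append)
    moreover have "(\<exists>j. increasing_run (u @ [y]) (length u) j) \<longleftrightarrow> y < last u"
      using that by (simp add: ex_increasing_run_iff nth_append last_conv_nth)
    ultimately show ?thesis
      by (simp add: run_first_letters_def)
  qed
  show ?case
    using step[of "h # v"] snoc.IH heads by simp
qed

text \<open>The new bound at each descent is the first letter of the run that it opens, so the
  bounds met along the word are the sequence of run heads, which is required to be sorted. The
  Catalan condition \<open>1 \<le> y\<close> at a descent is implied by \<open>m \<le> y\<close>.\<close>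

lemma continues_iff:
  assumes "m \<le> h" "1 \<le> m"
  shows "continues m h v \<longleftrightarrow>
    (\<forall>i. Suc i < length (h # v) \<longrightarrow>
        1 \<le> (h # v) ! Suc i \<and> (h # v) ! Suc i \<le> (h # v) ! i + 1) \<and>
    sorted (m # later_run_heads h v)"
  using assms
proof (induction v arbitrary: m h)
  case (Cons y v)
  have split: "(\<forall>i. Suc i < length (h # y # v) \<longrightarrow>
        1 \<le> (h # y # v) ! Suc i \<and> (h # y # v) ! Suc i \<le> (h # y # v) ! i + 1) \<longleftrightarrow>
     1 \<le> y \<and> y \<le> Suc h \<and>
     (\<forall>i. Suc i < length (y # v) \<longrightarrow> 1 \<le> (y # v) ! Suc i \<and> (y # v) ! Suc i \<le> (y # v) ! i + 1)"
    (is "(\<forall>i. ?P i) \<longleftrightarrow> ?a \<and> ?b \<and> (\<forall>i. ?Q i)")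
  proof -
    have "?P 0 \<longleftrightarrow> ?a \<and> ?b" "?P (Suc i) \<longleftrightarrow> ?Q i" for i by simp_all
    then show ?thesis by (metis not0_implies_Suc)
  qed
  show ?case
    unfolding split
  proof (cases "h \<le> y")
    case True
    then show "continues m h (y # v) \<longleftrightarrow> (1 \<le> y \<and> y \<le> Suc h \<and> (\<forall>i. Suc i < length (y # v) \<longrightarrow>
        1 \<le> (y # v) ! Suc i \<and> (y # v) ! Suc i \<le> (y # v) ! i + 1)) \<and>
        sorted (m # later_run_heads h (y # v))"
      using Cons.prems Cons.IH[of m y] by auto
  next
    case False
    then show "continues m h (y # v) \<longleftrightarrow> (1 \<le> y \<and> y \<le> Suc h \<and> (\<forall>i. Suc i < length (y # v) \<longrightarrow>
        1 \<le> (y # v) ! Suc i \<and> (y # v) ! Suc i \<le> (y # v) ! i + 1)) \<and>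
        sorted (m # later_run_heads h (y # v))"
      using Cons.prems Cons.IH[of y y] by (auto intro: order_trans)
  qed
qed auto

lemma flat_catalan_Suc: "flat_catalan (Suc n) = (#) 1 ` continuations n 1 1"
proof -
  have "1 # v \<in> flat_catalan (Suc n) \<longleftrightarrow> v \<in> continuations n 1 1" for v
    unfolding flat_catalan_def continuations_def catalan_word_def flattened_def
    by (simp add: run_first_letters_Cons continues_iff)
  moreover have "\<exists>v. w = 1 # v" if "w \<in> flat_catalan (Suc n)" for w
    using that by (cases w) (auto simp: flat_catalan_def catalan_word_def)
  ultimately show ?thesis unfolding image_def by blast
qed

lemma continuations_0: "continuations 0 m h = {[]}"
  by (auto simp: continuations_def)

lemma continuations_Suc:
  assumes "m \<le> h"
  shows "continuations (Suc n) m h =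
    (#) h ` continuations n m h \<union> (#) (Suc h) ` continuations n m (Suc h) \<union>
    (\<Union>y\<in>{m..<h}. (#) y ` continuations n y y)"
proof (rule set_eqI)
  fix u
  show "u \<in> continuations (Suc n) m h \<longleftrightarrow> u \<in> (#) h ` continuations n m h \<union>
      (#) (Suc h) ` continuations n m (Suc h) \<union> (\<Union>y\<in>{m..<h}. (#) y ` continuations n y y)"
    using assms
    by (cases u) (auto simp: continuations_def image_iff le_Suc_eq)
qed

lemma finite_continuations: "m \<le> h \<Longrightarrow> finite (continuations n m h)"
  by (induction n arbitrary: m h) (auto simp: continuations_0 continuations_Suc)

lemma sum_continuations_Suc:
  fixes \<Phi> :: "nat list \<Rightarrow> 'a::comm_monoid_add"
  assumes "m \<le> h"
  shows "(\<Sum>v\<in>continuations (Suc n) m h. \<Phi> v) =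
    (\<Sum>v\<in>continuations n m h. \<Phi> (h # v)) +
    (\<Sum>v\<in>continuations n m (Suc h). \<Phi> (Suc h # v)) +
    (\<Sum>y\<in>{m..<h}. \<Sum>v\<in>continuations n y y. \<Phi> (y # v))"
proof -
  have *: "sum \<Phi> ((#) y ` A) = (\<Sum>v\<in>A. \<Phi> (y # v))" for y A
    by (subst sum.reindex) (auto simp: inj_on_def)
  show ?thesis
    unfolding continuations_Suc[OF assms]
    apply (subst sum.union_disjoint)
       apply (use assms in \<open>auto simp: finite_continuations\<close>)[3]
    apply (subst sum.union_disjoint)
       apply (use assms in \<open>auto simp: finite_continuations\<close>)[3]
    apply (subst sum.UNION_disjoint)
       apply (auto simp: finite_continuations *)
    done
qed

section \<open>Reduction to the height above the current run head\<close>

text \<open>One step of the recursion in the height \<open>d\<close>: of the \<open>d\<close> letters to which a descent can lead, the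
  highest is reached by a \<open>Dip\<close> and the \<open>d - 1\<close> others by a \<open>Plunge\<close>; each of them is the head of
  its run, which puts the height back to \<open>0\<close>.\<close>

definition step_sum :: "(step \<Rightarrow> nat \<Rightarrow> 'a) \<Rightarrow> nat \<Rightarrow> 'a::comm_ring_1" where
  "step_sum K d = K Level d + K Rise (Suc d) +
     (if d = 0 then 0 else K Dip 0 + of_nat (d - 1) * K Plunge 0)"

lemma sum_falls:
  fixes K :: "step \<Rightarrow> 'a::comm_ring_1"
  assumes "m \<le> h"
  shows "(\<Sum>y\<in>{m..<h}. K (step_of h y)) =
    (if h - m = 0 then 0 else K Dip + of_nat (h - m - 1) * K Plunge)"
proof (cases "m = h")
  case False
  with assms obtain g where g: "h = Suc g" "m \<le> g" by (cases h) auto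
  have "(\<Sum>y\<in>{m..<h}. K (step_of h y)) = (\<Sum>y\<in>{m..<g}. K (step_of h y)) + K (step_of h g)"
    using g by simp
  also have "(\<Sum>y\<in>{m..<g}. K (step_of h y)) = (\<Sum>y\<in>{m..<g}. K Plunge)"
    using g by (intro sum.cong) (auto simp: step_of_def)
  finally show ?thesis using g by (simp add: step_of_def)
qed simp

lemma sum_continuations_step:
  fixes \<Phi> :: "nat list \<Rightarrow> 'a::comm_ring_1"
  assumes "m \<le> h"
    and "\<And>m' y. m' \<le> y \<Longrightarrow> y \<le> Suc h \<Longrightarrow>
      (\<Sum>v\<in>continuations n m' y. \<Phi> (y # v)) = K (step_of h y) (y - m')"
  shows "(\<Sum>v\<in>continuations (Suc n) m h. \<Phi> v) = step_sum K (h - m)"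
proof -
  have "(\<Sum>y\<in>{m..<h}. \<Sum>v\<in>continuations n y y. \<Phi> (y # v)) =
      (\<Sum>y\<in>{m..<h}. K (step_of h y) 0)"
    using assms(2) by (intro sum.cong) auto
  also have "\<dots> = (if h - m = 0 then 0 else K Dip 0 + of_nat (h - m - 1) * K Plunge 0)"
    by (rule sum_falls[OF assms(1), where K = "\<lambda>s. K s 0"])
  finally have falls: "(\<Sum>y\<in>{m..<h}. \<Sum>v\<in>continuations n y y. \<Phi> (y # v)) = \<dots>" .
  have "step_of h h = Level" "step_of h (Suc h) = Rise" by (simp_all add: step_of_def)
  then show ?thesis
    using assms(1) assms(2)[of m h] assms(2)[of m "Suc h"]
    by (simp add: sum_continuations_Suc falls step_sum_def Suc_diff_le)
qed

text \<open>A family \<open>W\<close> of numbers \<open>W p s\<close> describes a pattern: it is the number of occurrences that are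
  completed when the step \<open>s\<close> follows the step \<open>p\<close>, where \<open>p = None\<close> at the first letter of a word.\<close>

fun occ_steps :: "(step option \<Rightarrow> step \<Rightarrow> nat) \<Rightarrow> step option \<Rightarrow> nat \<Rightarrow> nat list \<Rightarrow> nat" where
  "occ_steps W p h [] = 0"
| "occ_steps W p h (y # v) = W p (step_of h y) + occ_steps W (Some (step_of h y)) y v"

primrec weight :: "'a \<Rightarrow> (step option \<Rightarrow> step \<Rightarrow> nat) \<Rightarrow> nat \<Rightarrow> step option \<Rightarrow> nat \<Rightarrow> 'a::comm_ring_1" where
  "weight q W 0 = (\<lambda>p d. 1)"
| "weight q W (Suc n) = (\<lambda>p d. step_sum (\<lambda>s e. q ^ W p s * weight q W n (Some s) e) d)"

lemma sum_weight:
  assumes "m \<le> h"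
  shows "(\<Sum>v\<in>continuations n m h. q ^ occ_steps W p h v) = weight q W n p (h - m)"
  using assms
proof (induction n arbitrary: p m h)
  case (Suc n)
  have "(\<Sum>v\<in>continuations n m' y. q ^ occ_steps W p h (y # v)) =
      q ^ W p (step_of h y) * weight q W n (Some (step_of h y)) (y - m')" if "m' \<le> y" for m' y
    using Suc.IH[OF that, of "Some (step_of h y)"]
    by (simp add: power_add sum_distrib_left[symmetric])
  then show ?case
    using sum_continuations_step[OF Suc.prems,
      where K = "\<lambda>s. \<lambda>e. q ^ W p s * weight q W n (Some s) e"
        and \<Phi> = "\<lambda>v. q ^ occ_steps W p h v" and n = n]
    by simp
qed (simp add: continuations_0)

text \<open>The solution of the recursion without weights. The coefficients come from the eigenvalues \<open>3\<close>
  and \<open>1\<close> of \<open>(a, b) \<mapsto> (2a + b, a + 2b)\<close>, which is the action of the recursion on \<open>a + b d\<close>.\<close>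

definition continuation_count :: "nat \<Rightarrow> nat \<Rightarrow> real" where
  "continuation_count n d = (3^n + 1) / 2 + (3^n - 1) / 2 * real d"

lemma continuation_count_Suc: "continuation_count (Suc n) d = step_sum (\<lambda>_. continuation_count n) d"
  by (cases d) (auto simp: continuation_count_def step_sum_def field_simps)

lemma card_continuations:
  assumes "m \<le> h"
  shows "real (card (continuations n m h)) = continuation_count n (h - m)"
proof -
  have "weight 1 (\<lambda>_ _. 0) n p d = continuation_count n d" for p d
  proof (induction n arbitrary: p d)
    case (Suc n)
    then show ?case by (simp add: continuation_count_Suc)
  qed (simp add: continuation_count_def)
  then show ?thesis using sum_weight[OF assms, where q = "1::real" and W = "\<lambda>_ _. 0"
      and n = n and p = None]
    by simp
qed

primrec occ_total :: "(step option \<Rightarrow> step \<Rightarrow> nat) \<Rightarrow> nat \<Rightarrow> step option \<Rightarrow> nat \<Rightarrow> real" where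
  "occ_total W 0 = (\<lambda>p d. 0)"
| "occ_total W (Suc n) =
     (\<lambda>p d. step_sum (\<lambda>s e. real (W p s) * continuation_count n e + occ_total W n (Some s) e) d)"

lemma sum_total:
  assumes "m \<le> h"
  shows "(\<Sum>v\<in>continuations n m h. real (occ_steps W p h v)) = occ_total W n p (h - m)"
  using assms
proof (induction n arbitrary: p m h)
  case (Suc n)
  have "(\<Sum>v\<in>continuations n m' y. real (occ_steps W p h (y # v))) =
      real (W p (step_of h y)) * continuation_count n (y - m') +
        occ_total W n (Some (step_of h y)) (y - m')" if "m' \<le> y" for m' y
    using Suc.IH[OF that, of "Some (step_of h y)"]
    by (simp add: sum.distrib card_continuations[OF that] mult.commute)
  then show ?case
    using sum_continuations_step[OF Suc.prems,
      where K = "\<lambda>s e. real (W p s) * continuation_count n e + occ_total W n (Some s) e"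
        and \<Phi> = "\<lambda>v. real (occ_steps W p h v)" and n = n]
    by simp
qed (simp add: continuations_0)

section \<open>Patterns as conditions on steps\<close>

definition step_pattern :: "step set \<Rightarrow> step option \<Rightarrow> step \<Rightarrow> nat" where
  "step_pattern S p s = of_bool (s \<in> S)"

definition step_pair_pattern :: "step set \<Rightarrow> step set \<Rightarrow> step option \<Rightarrow> step \<Rightarrow> nat" where
  "step_pair_pattern P S p s = of_bool (p \<in> Some ` P \<and> s \<in> S)"

text \<open>The condition \<open>continues m h v\<close> bounds each ascent by one. This is what allows an order pattern to be
  read off from steps: a \<open>Rise\<close> after a \<open>Plunge\<close> stays below the letter before the \<open>Plunge\<close>, and
  after a \<open>Dip\<close> it returns exactly to the letter before it.\<close>

definition encodes :: "(step option \<Rightarrow> step \<Rightarrow> nat) \<Rightarrow> nat list \<Rightarrow> bool" where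
  "encodes W t \<longleftrightarrow> (\<forall>m h v. continues m h v \<longrightarrow> occurrences t (h # v) = occ_steps W None h v)"

lemma occurrences_Cons:
  "occurrences t (x # w) =
     of_bool (length t \<le> Suc (length w) \<and> order_isomorphic (take (length t) (x # w)) t) + occurrences t w"
proof -
  let ?M = "\<lambda>w. {i. i + length t \<le> length w \<and> order_isomorphic (take (length t) (drop i w)) t}"
  have fin: "finite (?M w)" by (rule finite_subset[of _ "{..length w}"]) auto
  have split: "?M (x # w) = ?M (x # w) \<inter> {0} \<union> Suc ` ?M w"
  proof (rule set_eqI)
    fix i show "i \<in> ?M (x # w) \<longleftrightarrow> i \<in> ?M (x # w) \<inter> {0} \<union> Suc ` ?M w"
      by (cases i) auto
  qed
  have "card (?M (x # w)) = card (?M (x # w) \<inter> {0} \<union> Suc ` ?M w)"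
    using split by (rule arg_cong)
  also have "\<dots> = card (?M (x # w) \<inter> {0}) + card (Suc ` ?M w)"
    using fin by (intro card_Un_disjoint) auto
  also have "card (Suc ` ?M w) = occurrences t w"
    by (simp add: card_image occurrences_def)
  also have "card (?M (x # w) \<inter> {0}) =
      of_bool (length t \<le> Suc (length w) \<and> order_isomorphic (take (length t) (x # w)) t)"
    by (cases "0 \<in> ?M (x # w)") auto
  finally show ?thesis by (simp add: occurrences_def)
qed

lemma occurrences_short: "length w < length t \<Longrightarrow> occurrences t w = 0"
  by (simp add: occurrences_def)

lemma continues_ConsD:
  assumes "continues m h (y # v)"
  shows "y \<le> Suc h" and "\<exists>m'. continues m' y v"
  using assms by (auto split: if_splits)

lemma encodes_step_pattern:
  assumes "length t = 2"
    and "\<And>g h. h \<le> Suc g \<Longrightarrow> order_isomorphic [g, h] t \<longleftrightarrow> step_of g h \<in> S"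
  shows "encodes (step_pattern S) t"
proof -
  have "continues m h v \<Longrightarrow> occurrences t (h # v) = occ_steps (step_pattern S) p h v" for m h v p
  proof (induction v arbitrary: m h p)
    case Nil
    show ?case using assms(1) by (simp add: occurrences_short)
  next
    case (Cons y v)
    obtain m' where "y \<le> Suc h" "continues m' y v"
      using continues_ConsD[OF Cons.prems] by blast
    then show ?case
      using Cons.IH[of m' y "Some (step_of h y)"] assms
      by (simp add: occurrences_Cons[of t h] step_pattern_def)
  qed
  then show ?thesis by (auto simp: encodes_def)
qed

lemma encodes_step_pair_pattern:
  assumes "length t = 3"
    and "\<And>g h y. h \<le> Suc g \<Longrightarrow> y \<le> Suc h \<Longrightarrow>
      order_isomorphic [g, h, y] t \<longleftrightarrow> step_of g h \<in> P \<and> step_of h y \<in> S"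
  shows "encodes (step_pair_pattern P S) t"
proof -
  let ?W = "step_pair_pattern P S"
  have two: "occurrences t (g # h # v) = occ_steps ?W (Some (step_of g h)) h v"
    if "h \<le> Suc g" "continues m h v" for m g h v
    using that
  proof (induction v arbitrary: m g h)
    case Nil
    show ?case using assms(1) by (simp add: occurrences_short)
  next
    case (Cons y v)
    obtain m' where "y \<le> Suc h" "continues m' y v"
      using continues_ConsD[OF Cons.prems(2)] by blast
    then show ?case
      using Cons.IH[of y h m'] Cons.prems(1) assms
      by (auto simp: occurrences_Cons[of t g] step_pair_pattern_def numeral_3_eq_3)
  qed
  have "occurrences t (h # v) = occ_steps ?W None h v" if cont: "continues m h v" for m h v
  proof (cases v)
    case Nil
    then show ?thesis using assms(1) by (simp add: occurrences_short)
  next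
    case (Cons y v')
    obtain m' where "y \<le> Suc h" "continues m' y v'"
      using cont continues_ConsD[of m h y v'] unfolding Cons by blast
    with two[of y h m' v'] show ?thesis
      by (simp add: Cons step_pair_pattern_def)
  qed
  then show ?thesis by (auto simp: encodes_def)
qed

lemma order_isomorphic_pair:
  "order_isomorphic [g, h] [a, b] \<longleftrightarrow> (g < h \<longleftrightarrow> a < b) \<and> (h < g \<longleftrightarrow> b < a)"
  by (auto simp: order_isomorphic_def less_Suc_eq)

lemma order_isomorphic_triple:
  "order_isomorphic [g, h, y] [a, b, c] \<longleftrightarrow>
    (g < h \<longleftrightarrow> a < b) \<and> (h < g \<longleftrightarrow> b < a) \<and> (g < y \<longleftrightarrow> a < c) \<and> (y < g \<longleftrightarrow> c < a) \<and>
    (h < y \<longleftrightarrow> b < c) \<and> (y < h \<longleftrightarrow> c < b)"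
  by (auto simp: order_isomorphic_def less_Suc_eq)

lemma step_of_eq_iff:
  "step_of g h = Level \<longleftrightarrow> h = g"
  "step_of g h = Rise \<longleftrightarrow> g < h"
  "step_of g h = Dip \<longleftrightarrow> Suc h = g"
  "step_of g h = Plunge \<longleftrightarrow> Suc h < g"
  by (auto simp: step_of_def)

abbreviation "falls \<equiv> {Dip, Plunge}"

lemma encodes_pairs:
  "encodes (step_pattern {Level}) [1,1]"
  "encodes (step_pattern {Rise}) [1,2]"
  "encodes (step_pattern falls) [2,1]"
  by (rule encodes_step_pattern; auto simp: order_isomorphic_pair step_of_eq_iff)+

lemma encodes_triples:
  "encodes (step_pair_pattern {Level} {Level}) [1,1,1]"
  "encodes (step_pair_pattern {Level} {Rise}) [1,1,2]"
  "encodes (step_pair_pattern {Rise} {Level}) [1,2,2]"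
  "encodes (step_pair_pattern {Rise} {Dip}) [1,2,1]"
  "encodes (step_pair_pattern {Rise} {Rise}) [1,2,3]"
  "encodes (step_pair_pattern falls {Level}) [2,1,1]"
  "encodes (step_pair_pattern {Level} falls) [2,2,1]"
  "encodes (step_pair_pattern {Rise} {Plunge}) [2,3,1]"
  "encodes (step_pair_pattern {Dip} {Rise}) [2,1,2]"
  "encodes (step_pair_pattern {Plunge} {Rise}) [3,1,2]"
  by (rule encodes_step_pair_pattern; auto simp: order_isomorphic_triple step_of_eq_iff)+

lemma sum_flat_catalan:
  assumes "encodes W t"
  shows "(\<Sum>w\<in>flat_catalan (Suc n). f (occurrences t w)) =
    (\<Sum>v\<in>continuations n 1 1. f (occ_steps W None 1 v))"
  unfolding flat_catalan_Suc
  by (subst sum.reindex) (use assms in \<open>auto simp: encodes_def continuations_def intro!: sum.cong\<close>)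

lemma tot_Suc: "encodes W t \<Longrightarrow> real (tot (Suc n) t) = occ_total W n None 0"
  using sum_total[of 1 1 W None n]
  by (simp add: tot_def sum_flat_catalan[where f = real])

section \<open>A finite linear system for the generating functions\<close>

definition series :: "'a \<Rightarrow> (step option \<Rightarrow> step \<Rightarrow> nat) \<Rightarrow> step option \<Rightarrow> nat \<Rightarrow> 'a::comm_ring_1 fps" where
  "series q W p d = Abs_fps (\<lambda>n. weight q W n p d)"

lemma flat_gf_eq: "encodes W t \<Longrightarrow> flat_gf t = fps_X * series q_var W None 0"
proof (rule fps_ext)
  fix n assume "encodes W t"
  then show "fps_nth (flat_gf t) n = fps_nth (fps_X * series q_var W None 0) n"
    using sum_weight[of 1 1 q_var W None "n - 1"]
      sum_flat_catalan[where n = "n - 1" and f = "\<lambda>k. q_var ^ k"]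
    by (cases n) (simp_all add: flat_gf_def series_def)
qed

lemma series_rec:
  "series q W p d = 1 + fps_X * step_sum (\<lambda>s e. fps_const q ^ W p s * series q W (Some s) e) d"
proof (rule fps_ext)
  fix n
  show "fps_nth (series q W p d) n =
    fps_nth (1 + fps_X * step_sum (\<lambda>s e. fps_const q ^ W p s * series q W (Some s) e) d) n"
    by (cases n) (auto simp: series_def step_sum_def fps_const_power fps_of_nat[symmetric] mult.assoc)
qed

text \<open>All terms of the recursion are affine in the height once a \<open>Dip\<close> is possible. At height \<open>0\<close>
  affinity may break down, because there the recursion has no falls at all, whereas
  the formula for \<open>d \<ge> 1\<close> would give the difference of the values after a \<open>Dip\<close> and a \<open>Plunge\<close>.\<close>

lemma weight_second_difference:
  "weight q W n p (Suc (Suc (Suc d))) = 2 * weight q W n p (Suc (Suc d)) - weight q W n p (Suc d)"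
proof (induction n arbitrary: p d)
  case (Suc n)
  show ?case
    unfolding weight.simps step_sum_def Suc.IH
    by (simp add: algebra_simps)
qed simp

text \<open>If the pattern sees no difference between the two kinds of fall, then affinity after a
  \<open>Level\<close> step extends to height \<open>0\<close>. Falls after a \<open>Rise\<close> are exempt, since after it the height is
  positive.\<close>

lemma weight_second_difference_0:
  assumes "W (Some Dip) = W (Some Plunge)" "W (Some Level) Dip = W (Some Level) Plunge"
  shows "weight q W n (Some Level) 2 = 2 * weight q W n (Some Level) 1 - weight q W n (Some Level) 0"
proof (induction n)
  case (Suc n)
  have fall: "weight q W n (Some Dip) 0 = weight q W n (Some Plunge) 0"
    using assms(1) by (cases n) simp_all
  have R: "weight q W n (Some Rise) 3 =
      2 * weight q W n (Some Rise) (Suc (Suc 0)) - weight q W n (Some Rise) (Suc 0)"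
    using weight_second_difference[of q W n "Some Rise" 0]
    by (simp add: numeral_2_eq_2 numeral_3_eq_3)
  show ?case
    using fall assms(2) by (simp add: step_sum_def Suc.IH R algebra_simps)
qed simp

lemma series_Level_second_difference:
  assumes "W (Some Dip) = W (Some Plunge)" "W (Some Level) Dip = W (Some Level) Plunge"
  shows "series q W (Some Level) 2 = 2 * series q W (Some Level) 1 - series q W (Some Level) 0"
proof (rule fps_ext)
  fix n
  show "fps_nth (series q W (Some Level) 2) n =
      fps_nth (2 * series q W (Some Level) 1 - series q W (Some Level) 0) n"
    unfolding series_def mult_2 using weight_second_difference_0[OF assms, of q n]
    by (simp only: fps_sub_nth fps_add_nth fps_nth_Abs_fps mult_2)
qed

lemma series_Rise_second_difference:
  "series q W (Some Rise) 3 = 2 * series q W (Some Rise) 2 - series q W (Some Rise) 1"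
proof (rule fps_ext)
  fix n
  have "weight q W n (Some Rise) 3 = 2 * weight q W n (Some Rise) 2 - weight q W n (Some Rise) 1"
    using weight_second_difference[of q W n "Some Rise" 0]
    by (simp add: numeral_2_eq_2 numeral_3_eq_3)
  then show "fps_nth (series q W (Some Rise) 3) n =
      fps_nth (2 * series q W (Some Rise) 2 - series q W (Some Rise) 1) n"
    by (simp only: series_def fps_sub_nth fps_add_nth fps_nth_Abs_fps mult_2)
qed

text \<open>At height \<open>2\<close> a rise leads to height \<open>3\<close>, whose series is replaced using affinity. This is what
  makes the system finite.\<close>

lemma series_at:
  fixes q :: "'a::comm_ring_1"
  shows "series q W p 0 = 1 + fps_X * (fps_const q ^ W p Level * series q W (Some Level) 0 +
      fps_const q ^ W p Rise * series q W (Some Rise) 1)"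
    and "series q W p 1 = 1 + fps_X * (fps_const q ^ W p Level * series q W (Some Level) 1 +
      fps_const q ^ W p Rise * series q W (Some Rise) 2 +
      fps_const q ^ W p Dip * series q W (Some Dip) 0)"
    and "series q W p 2 = 1 + fps_X * (fps_const q ^ W p Level * series q W (Some Level) 2 +
      fps_const q ^ W p Rise * (2 * series q W (Some Rise) 2 - series q W (Some Rise) 1) +
      fps_const q ^ W p Dip * series q W (Some Dip) 0 +
      fps_const q ^ W p Plunge * series q W (Some Plunge) 0)"
  unfolding series_Rise_second_difference[symmetric]
  by (subst series_rec, simp add: step_sum_def add.assoc flip: numeral_2_eq_2)+

text \<open>Rises and falls lead to the series listed here and to no others. The order of the equations
  guides the Groebner basis computations below.\<close>

lemmas series_system =
  series_at(1)[of q W None] series_at[of q W "Some Level"] series_at(2,3)[of q W "Some Rise"]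
  series_at(1)[of q W "Some Dip"] series_at(1)[of q W "Some Plunge"] for q W

text \<open>The denominators have nonzero constant term, so division in the ring of power series
  is exact.\<close>

lemma flat_gf_eqI:
  assumes "encodes W t" and "den * series q_var W None 0 = num" and "fps_nth den 0 \<noteq> 0"
  shows "flat_gf t = fps_X * num / den"
proof -
  have "den \<noteq> 0" using assms(3) by auto
  then show ?thesis
    unfolding flat_gf_eq[OF assms(1)] assms(2)[symmetric]
    by (simp add: mult.left_commute[of _ den])
qed

section \<open>Solving the system for each pattern\<close>

text \<open>Each formula below is an ideal membership: the equation follows from the linear system
  by eliminating all series except the wanted one. For all patterns except 212 and 312
  affinity down to height \<open>0\<close> is supplied as a further equation. It does follow from the system, but only
  after a common factor has been cancelled, which is beyond ideal membership.\<close>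

lemma series_Level:
  fixes q :: "'a::idom"
  defines "x \<equiv> fps_X" and "r \<equiv> fps_const q"
  shows "(1 - 2 * (1 + r) * x + r * (2 + r) * x^2) *
    series q (step_pattern {Level}) None 0 =
    1 - (1 + r) * x"
  using series_system[of q "step_pattern {Level}", simplified step_pattern_def, simplified, folded x_def r_def]
    series_Level_second_difference[of "step_pattern {Level}" q, simplified step_pattern_def fun_eq_iff, simplified]
  by algebra

lemma series_Rise:
  fixes q :: "'a::idom"
  defines "x \<equiv> fps_X" and "r \<equiv> fps_const q"
  shows "(1 - 2 * (1 + r) * x + (1 + r + r^2) * x^2) *
    series q (step_pattern {Rise}) None 0 =
    1 - (1 + r) * x"
  using series_system[of q "step_pattern {Rise}", simplified step_pattern_def, simplified, folded x_def r_def]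
    series_Level_second_difference[of "step_pattern {Rise}" q, simplified step_pattern_def fun_eq_iff, simplified]
  by algebra

lemma series_falls:
  fixes q :: "'a::idom"
  defines "x \<equiv> fps_X" and "r \<equiv> fps_const q"
  shows "(1 - 4 * x + (4 - r) * x^2) *
    series q (step_pattern falls) None 0 =
    1 - 2 * x"
  using series_system[of q "step_pattern falls", simplified step_pattern_def, simplified, folded x_def r_def]
    series_Level_second_difference[of "step_pattern falls" q, simplified step_pattern_def fun_eq_iff, simplified]
  by algebra

lemma series_Level_Level:
  fixes q :: "'a::idom"
  defines "x \<equiv> fps_X" and "r \<equiv> fps_const q"
  shows "(1 - 2 * (1 + r) * x - (2 - 4 * r - r^2) * x^2 + 2 * r * (1 - r) * x^3) *
    series q (step_pair_pattern {Level} {Level}) None 0 =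
    (1 + (1 - r) * x) * (1 - (1 + r) * x - (1 - r) * x^2)"
  using series_system[of q "step_pair_pattern {Level} {Level}", simplified step_pair_pattern_def, simplified, folded x_def r_def]
    series_Level_second_difference[of "step_pair_pattern {Level} {Level}" q, simplified step_pair_pattern_def fun_eq_iff, simplified]
  by algebra

lemma series_Level_Rise:
  fixes q :: "'a::idom"
  defines "x \<equiv> fps_X" and "r \<equiv> fps_const q"
  shows "(1 - 4 * x + (5 - 2 * r) * x^2 - 3 * (1 - r) * x^3 + (1 - r)^2 * x^4) *
    series q (step_pair_pattern {Level} {Rise}) None 0 =
    1 - 2 * x + (1 - r) * x^2"
  using series_system[of q "step_pair_pattern {Level} {Rise}", simplified step_pair_pattern_def, simplified, folded x_def r_def]
    series_Level_second_difference[of "step_pair_pattern {Level} {Rise}" q, simplified step_pair_pattern_def fun_eq_iff, simplified]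
  by algebra

lemma series_Rise_Level:
  fixes q :: "'a::idom"
  defines "x \<equiv> fps_X" and "r \<equiv> fps_const q"
  shows "(1 - 4 * x + (5 - 2 * r) * x^2 - 3 * (1 - r) * x^3 + (1 - r)^2 * x^4) *
    series q (step_pair_pattern {Rise} {Level}) None 0 =
    1 - 2 * x + (1 - r) * x^2"
  using series_system[of q "step_pair_pattern {Rise} {Level}", simplified step_pair_pattern_def, simplified, folded x_def r_def]
    series_Level_second_difference[of "step_pair_pattern {Rise} {Level}" q, simplified step_pair_pattern_def fun_eq_iff, simplified]
  by algebra

lemma series_Rise_Dip:
  fixes q :: "'a::idom"
  defines "x \<equiv> fps_X" and "r \<equiv> fps_const q"
  shows "(1 - 4 * x + (4 - r) * x^2 - 2 * (1 - r) * x^3) *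
    series q (step_pair_pattern {Rise} {Dip}) None 0 =
    1 - 2 * x"
  using series_system[of q "step_pair_pattern {Rise} {Dip}", simplified step_pair_pattern_def, simplified, folded x_def r_def]
    series_Level_second_difference[of "step_pair_pattern {Rise} {Dip}" q, simplified step_pair_pattern_def fun_eq_iff, simplified]
  by algebra

lemma series_Rise_Rise:
  fixes q :: "'a::idom"
  defines "x \<equiv> fps_X" and "r \<equiv> fps_const q"
  shows "(1 - 2 * (1 + r) * x - (2 - 4 * r - r^2) * x^2 + 2 * (1 - r^2) * x^3 + (1 - r)^2 * x^4) *
    series q (step_pair_pattern {Rise} {Rise}) None 0 =
    (1 + (1 - r) * x) * (1 - (1 + r) * x - (1 - r) * x^2)"
  using series_system[of q "step_pair_pattern {Rise} {Rise}", simplified step_pair_pattern_def, simplified, folded x_def r_def]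
    series_Level_second_difference[of "step_pair_pattern {Rise} {Rise}" q, simplified step_pair_pattern_def fun_eq_iff, simplified]
  by algebra

lemma series_falls_Level:
  fixes q :: "'a::idom"
  defines "x \<equiv> fps_X" and "r \<equiv> fps_const q"
  shows "(1 - 4 * x + 3 * x^2 + (1 - r) * x^3) *
    series q (step_pair_pattern falls {Level}) None 0 =
    1 - 2 * x"
  using series_system[of q "step_pair_pattern falls {Level}", simplified step_pair_pattern_def, simplified, folded x_def r_def]
    series_Level_second_difference[of "step_pair_pattern falls {Level}" q, simplified step_pair_pattern_def fun_eq_iff, simplified]
  by algebra

lemma series_Level_falls:
  fixes q :: "'a::idom"
  defines "x \<equiv> fps_X" and "r \<equiv> fps_const q"
  shows "(1 - 4 * x + 3 * x^2 + (1 - r) * x^3) *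
    series q (step_pair_pattern {Level} falls) None 0 =
    1 - 2 * x"
  using series_system[of q "step_pair_pattern {Level} falls", simplified step_pair_pattern_def, simplified, folded x_def r_def]
    series_Level_second_difference[of "step_pair_pattern {Level} falls" q, simplified step_pair_pattern_def fun_eq_iff, simplified]
  by algebra

lemma series_Rise_Plunge:
  fixes q :: "'a::idom"
  defines "x \<equiv> fps_X" and "r \<equiv> fps_const q"
  shows "(1 - 4 * x + 3 * x^2 + (1 - r) * x^3) *
    series q (step_pair_pattern {Rise} {Plunge}) None 0 =
    1 - 2 * x"
  using series_system[of q "step_pair_pattern {Rise} {Plunge}", simplified step_pair_pattern_def, simplified, folded x_def r_def]
    series_Level_second_difference[of "step_pair_pattern {Rise} {Plunge}" q, simplified step_pair_pattern_def fun_eq_iff, simplified]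
  by algebra

text \<open>For 212 and 312 a \<open>Rise\<close> is weighted differently after the two kinds of fall, so affinity fails at height
  \<open>0\<close>. The elimination then leaves the factor \<open>1 - x\<close> in the denominator.\<close>

lemma series_Dip_Rise:
  fixes q :: "'a::idom"
  defines "x \<equiv> fps_X" and "r \<equiv> fps_const q"
  shows "((1 - x) * (1 - 4 * x + (4 - r) * x^2 - 2 * (1 - r) * x^3)) *
    series q (step_pair_pattern {Dip} {Rise}) None 0 =
    1 - 3 * x + (3 - r) * x^2 - 2 * (1 - r) * x^3"
  using series_system[of q "step_pair_pattern {Dip} {Rise}", simplified step_pair_pattern_def, simplified, folded x_def r_def]
  by algebra

lemma series_Plunge_Rise:
  fixes q :: "'a::idom"
  defines "x \<equiv> fps_X" and "r \<equiv> fps_const q"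
  shows "((1 - x) * (1 - 4 * x + 3 * x^2 + (1 - r) * x^3)) *
    series q (step_pair_pattern {Plunge} {Rise}) None 0 =
    1 - 3 * x + 2 * x^2 + (1 - r) * x^3"
  using series_system[of q "step_pair_pattern {Plunge} {Rise}", simplified step_pair_pattern_def, simplified, folded x_def r_def]
  by algebra

section \<open>Totals\<close>

text \<open>The recursion in the height with an inhomogeneous term \<open>g\<close>, where \<open>g n d\<close> is the total
  contribution of the occurrences that start at the current position.\<close>

primrec accumulated :: "(nat \<Rightarrow> nat \<Rightarrow> real) \<Rightarrow> nat \<Rightarrow> nat \<Rightarrow> real" where
  "accumulated g 0 = (\<lambda>d. 0)"
| "accumulated g (Suc n) = (\<lambda>d. step_sum (\<lambda>_. accumulated g n) d + g n d)"

lemma step_sum_add: "step_sum (\<lambda>s e. K s e + L s e) d = step_sum K d + step_sum L d"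
  by (simp add: step_sum_def algebra_simps)

lemma total_step_pattern:
  "occ_total (step_pattern S) n p d =
    accumulated (\<lambda>n. step_sum (\<lambda>s e. of_bool (s \<in> S) * continuation_count n e)) n d"
  by (induction n arbitrary: p d) (simp_all add: step_pattern_def step_sum_add)

text \<open>Occurrences that start earlier than the current letter, at the step \<open>p\<close> leading to it, are
  split off as \<open>first n p\<close>. What remains does not depend on \<open>p\<close>. It lags behind by one letter,
  because a pair of steps cannot be completed by a single further letter.\<close>

lemma total_step_pair_pattern:
  fixes P S
  defines "first \<equiv> \<lambda>n p. step_sum (\<lambda>s e. of_bool (p \<in> Some ` P \<and> s \<in> S) * continuation_count n e)"
  shows "occ_total (step_pair_pattern P S) (Suc n) p d =
    accumulated (\<lambda>n. step_sum (\<lambda>r. first n (Some r))) n d + first n p d"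
proof (induction n arbitrary: p d)
  case 0
  show ?case by (simp add: first_def step_pair_pattern_def)
next
  case (Suc n)
  have IH: "occ_total (step_pair_pattern P S) (Suc n) (Some r) =
      (\<lambda>e. accumulated (\<lambda>n. step_sum (\<lambda>r. first n (Some r))) n e + first n (Some r) e)" for r
    by (rule ext) (rule Suc.IH)
  have "occ_total (step_pair_pattern P S) (Suc (Suc n)) p d =
      first (Suc n) p d + step_sum (\<lambda>r. occ_total (step_pair_pattern P S) (Suc n) (Some r)) d"
    by (simp only: occ_total.simps(2)[of _ "Suc n"] step_sum_add) (simp add: first_def step_pair_pattern_def)
  also have "\<dots> = first (Suc n) p d + (step_sum (\<lambda>_. accumulated (\<lambda>n. step_sum (\<lambda>r. first n (Some r))) n) d
     + step_sum (\<lambda>r. first n (Some r)) d)"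
    by (simp only: IH step_sum_add)
  finally show ?case by simp
qed

lemma tot_pair:
  assumes "encodes (step_pattern S) t"
  shows "real (tot (Suc n) t) =
    accumulated (\<lambda>n. step_sum (\<lambda>s e. of_bool (s \<in> S) * continuation_count n e)) n 0"
  by (simp add: tot_Suc[OF assms] total_step_pattern)

lemma step_sum_0: "step_sum (\<lambda>s e. 0) d = 0"
  by (simp add: step_sum_def)

lemma tot_triple:
  assumes "encodes (step_pair_pattern P S) t"
  shows "real (tot (Suc (Suc n)) t) =
    accumulated (\<lambda>n. step_sum (\<lambda>r e. of_bool (r \<in> P) *
      step_sum (\<lambda>s e'. of_bool (s \<in> S) * continuation_count n e') e)) n 0"
proof -
  have "step_sum (\<lambda>s e. of_bool (Some r \<in> Some ` P \<and> s \<in> S) * continuation_count n e) =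
      (\<lambda>e. of_bool (r \<in> P) * step_sum (\<lambda>s e'. of_bool (s \<in> S) * continuation_count n e') e)" for n r
    by (cases "r \<in> P") (auto simp: step_sum_0 image_iff)
  then show ?thesis
    by (simp add: tot_Suc[OF assms] total_step_pair_pattern step_sum_0 del: occ_total.simps)
qed

text \<open>Closed forms are verified rather than derived. They are of the shape
  \<open>A n + B n * d + C n * [d > 0]\<close>; the powers of \<open>3\<close> and the constants in them can carry coefficients
  linear in \<open>n\<close> because the inhomogeneous terms are in resonance with the eigenvalues \<open>3\<close> and \<open>1\<close>.\<close>

lemma accumulated_eqI:
  assumes "\<And>d. f 0 d = 0" and "\<And>n d. f (Suc n) d = step_sum (\<lambda>_. f n) d + g n d"
  shows "accumulated g n d = f n d"
proof -
  have "accumulated g n = f n"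
  proof (induction n)
    case (Suc n)
    show ?case by (rule ext) (simp add: Suc.IH assms(2))
  qed (simp add: fun_eq_iff assms(1))
  then show ?thesis by simp
qed

lemma accumulated_Level: "accumulated (\<lambda>n d. continuation_count n d) n d =
    real n * (3^n + 3) / 6 + real d * (real n * (3^n - 3) / 6)"
  by (rule accumulated_eqI; simp add: step_sum_def continuation_count_def of_nat_diff field_simps)

lemma accumulated_Rise: "accumulated (\<lambda>n d. continuation_count n (Suc d)) n d =
    real n * (3^n + 1) / 4 + real d * ((real n - 1) * (3^n - 1) / 4)"
  by (rule accumulated_eqI; simp add: step_sum_def continuation_count_def of_nat_diff field_simps)

lemma accumulated_fall: "accumulated (\<lambda>n d. real d * continuation_count n 0) n d =
    real n * (3^n - 3) / 12 + real d * ((real n + 3) * 3^n / 12 + (real n - 1) / 4)"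
  by (rule accumulated_eqI; simp add: step_sum_def continuation_count_def of_nat_diff field_simps)

lemma accumulated_Rise_Dip: "accumulated (\<lambda>n d. continuation_count n 0) n d =
    (real n + 3) * 3^n / 12 + (real n - 1) / 4 + real d * (real n * (3^n - 3) / 12)"
  by (rule accumulated_eqI; simp add: step_sum_def continuation_count_def of_nat_diff field_simps)

lemma accumulated_Rise_Rise: "accumulated (\<lambda>n d. continuation_count n (Suc (Suc d))) n d =
    real n * 3^n / 3 + real d * ((2 * real n - 3) * 3^n / 6 + 1 / 2)"
  by (rule accumulated_eqI; simp add: step_sum_def continuation_count_def of_nat_diff field_simps)

lemma accumulated_Dip_Rise: "accumulated (\<lambda>n d. of_bool (d > 0) * continuation_count n 1) n d =
    real n * (3^n - 3) / 12 + real d * ((real n - 3) * 3^n / 12 + (real n + 1) / 4)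
      + of_bool (d > 0) * ((3^n - 1) / 2)"
  by (rule accumulated_eqI; simp add: step_sum_def continuation_count_def of_nat_diff field_simps)

lemma accumulated_Plunge_Rise: "accumulated (\<lambda>n d. of_bool (d > 0) * (real d - 1) * continuation_count n 1) n d =
    (real n - 3) * 3^n / 12 + (real n + 1) / 4 + real d * ((real n + 6) * 3^n / 12 - (real n + 2) / 4)
      - of_bool (d > 0) * ((3^n - 1) / 2)"
  by (rule accumulated_eqI; simp add: step_sum_def continuation_count_def of_nat_diff field_simps)

lemma tot_pair_patterns:
  "real (tot (Suc n) [1,1]) = accumulated (\<lambda>n d. continuation_count n d) n 0"
  "real (tot (Suc n) [1,2]) = accumulated (\<lambda>n d. continuation_count n (Suc d)) n 0"
  "real (tot (Suc n) [2,1]) = accumulated (\<lambda>n d. real d * continuation_count n 0) n 0"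
proof -
  have "step_sum (\<lambda>s e. of_bool (s \<in> {Level}) * continuation_count n e) = (\<lambda>d. continuation_count n d)"
    "step_sum (\<lambda>s e. of_bool (s \<in> {Rise}) * continuation_count n e) = (\<lambda>d. continuation_count n (Suc d))"
    "step_sum (\<lambda>s e. of_bool (s \<in> falls) * continuation_count n e) = (\<lambda>d. real d * continuation_count n 0)" for n
    by (simp_all add: fun_eq_iff step_sum_def of_nat_diff algebra_simps)
  with encodes_pairs[THEN tot_pair, of n] show
  "real (tot (Suc n) [1,1]) = accumulated (\<lambda>n d. continuation_count n d) n 0"
  "real (tot (Suc n) [1,2]) = accumulated (\<lambda>n d. continuation_count n (Suc d)) n 0"
  "real (tot (Suc n) [2,1]) = accumulated (\<lambda>n d. real d * continuation_count n 0) n 0"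
    by (simp_all only:)
qed

text \<open>In each case \<open>g n d\<close> counts the continuations that are left after the two steps of the pattern have
  been made from height \<open>d\<close>. For 221 and 231, for instance, the second step can be
  made in \<open>d\<close> ways, as can the first step for 211, and the height is \<open>0\<close> after the pattern.\<close>

lemma tot_triple_patterns:
  "real (tot (Suc (Suc n)) [1,1,1]) = accumulated (\<lambda>n d. continuation_count n d) n 0"
  "real (tot (Suc (Suc n)) [1,1,2]) = accumulated (\<lambda>n d. continuation_count n (Suc d)) n 0"
  "real (tot (Suc (Suc n)) [1,2,2]) = accumulated (\<lambda>n d. continuation_count n (Suc d)) n 0"
  "real (tot (Suc (Suc n)) [1,2,1]) = accumulated (\<lambda>n d. continuation_count n 0) n 0"
  "real (tot (Suc (Suc n)) [1,2,3]) = accumulated (\<lambda>n d. continuation_count n (Suc (Suc d))) n 0"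
  "real (tot (Suc (Suc n)) [2,1,1]) = accumulated (\<lambda>n d. real d * continuation_count n 0) n 0"
  "real (tot (Suc (Suc n)) [2,2,1]) = accumulated (\<lambda>n d. real d * continuation_count n 0) n 0"
  "real (tot (Suc (Suc n)) [2,3,1]) = accumulated (\<lambda>n d. real d * continuation_count n 0) n 0"
  "real (tot (Suc (Suc n)) [2,1,2]) = accumulated (\<lambda>n d. of_bool (d > 0) * continuation_count n 1) n 0"
  "real (tot (Suc (Suc n)) [3,1,2]) = accumulated (\<lambda>n d. of_bool (d > 0) * (real d - 1) * continuation_count n 1) n 0"
  unfolding encodes_triples[THEN tot_triple]
  by (rule arg_cong[where f = "\<lambda>g. accumulated g n 0"];
      simp add: fun_eq_iff step_sum_def of_nat_diff algebra_simps)+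

section \<open>The formulas\<close>

lemma flat_gf_formulas:
  fixes x q :: "int poly fract fps"
  assumes "x = fps_X" and "q = fps_const q_var"
  shows "flat_gf [1,1] = x * (1 - (1 + q) * x)
      / (1 - 2 * (1 + q) * x + q * (2 + q) * x^2)"
    and "flat_gf [1,2] = x * (1 - (1 + q) * x)
      / (1 - 2 * (1 + q) * x + (1 + q + q^2) * x^2)"
    and "flat_gf [2,1] = x * (1 - 2 * x)
      / (1 - 4 * x + (4 - q) * x^2)"
    and "flat_gf [1,1,1] = x * (1 + (1 - q) * x) * (1 - (1 + q) * x - (1 - q) * x^2)
      / (1 - 2 * (1 + q) * x - (2 - 4 * q - q^2) * x^2 + 2 * q * (1 - q) * x^3)"
    and "flat_gf [1,1,2] = x * (1 - 2 * x + (1 - q) * x^2)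
      / (1 - 4 * x + (5 - 2 * q) * x^2 - 3 * (1 - q) * x^3 + (1 - q)^2 * x^4)"
    and "flat_gf [1,2,2] = x * (1 - 2 * x + (1 - q) * x^2)
      / (1 - 4 * x + (5 - 2 * q) * x^2 - 3 * (1 - q) * x^3 + (1 - q)^2 * x^4)"
    and "flat_gf [1,2,1] = x * (1 - 2 * x)
      / (1 - 4 * x + (4 - q) * x^2 - 2 * (1 - q) * x^3)"
    and "flat_gf [1,2,3] = x * (1 + (1 - q) * x) * (1 - (1 + q) * x - (1 - q) * x^2)
      / (1 - 2 * (1 + q) * x - (2 - 4 * q - q^2) * x^2 + 2 * (1 - q^2) * x^3 + (1 - q)^2 * x^4)"
    and "flat_gf [2,1,1] = x * (1 - 2 * x)
      / (1 - 4 * x + 3 * x^2 + (1 - q) * x^3)"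
    and "flat_gf [2,2,1] = x * (1 - 2 * x)
      / (1 - 4 * x + 3 * x^2 + (1 - q) * x^3)"
    and "flat_gf [2,3,1] = x * (1 - 2 * x)
      / (1 - 4 * x + 3 * x^2 + (1 - q) * x^3)"
    and "flat_gf [2,1,2] = x * (1 - 3 * x + (3 - q) * x^2 - 2 * (1 - q) * x^3)
      / ((1 - x) * (1 - 4 * x + (4 - q) * x^2 - 2 * (1 - q) * x^3))"
    and "flat_gf [3,1,2] = x * (1 - 3 * x + 2 * x^2 + (1 - q) * x^3)
      / ((1 - x) * (1 - 4 * x + 3 * x^2 + (1 - q) * x^3))"
  unfolding mult.assoc[of x]
  by ((rule
      flat_gf_eqI[OF encodes_pairs(1) series_Level, folded assms]
      flat_gf_eqI[OF encodes_pairs(2) series_Rise, folded assms]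
      flat_gf_eqI[OF encodes_pairs(3) series_falls, folded assms]
      flat_gf_eqI[OF encodes_triples(1) series_Level_Level, folded assms]
      flat_gf_eqI[OF encodes_triples(2) series_Level_Rise, folded assms]
      flat_gf_eqI[OF encodes_triples(3) series_Rise_Level, folded assms]
      flat_gf_eqI[OF encodes_triples(4) series_Rise_Dip, folded assms]
      flat_gf_eqI[OF encodes_triples(5) series_Rise_Rise, folded assms]
      flat_gf_eqI[OF encodes_triples(6) series_falls_Level, folded assms]
      flat_gf_eqI[OF encodes_triples(7) series_Level_falls, folded assms]
      flat_gf_eqI[OF encodes_triples(8) series_Rise_Plunge, folded assms]
      flat_gf_eqI[OF encodes_triples(9) series_Dip_Rise, folded assms]
      flat_gf_eqI[OF encodes_triples(10) series_Plunge_Rise, folded assms],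
      simp add: assms(1) fps_power_zeroth)+)

lemma powi_shift:
  "(3::real) powi (int (Suc (Suc k)) - 1) = 3 * 3 ^ k"
  "(3::real) powi (int (Suc (Suc k)) - 2) = 3 ^ k"
  "(3::real) powi (int (Suc (Suc k)) - 3) = 3 ^ k / 3"
proof -
  have *: "int (Suc (Suc k)) - 1 = int (Suc k)" "int (Suc (Suc k)) - 2 = int k"
    "int (Suc (Suc k)) - 3 = int k - 1" by simp_all
  show "(3::real) powi (int (Suc (Suc k)) - 1) = 3 * 3 ^ k"
    "(3::real) powi (int (Suc (Suc k)) - 2) = 3 ^ k"
    "(3::real) powi (int (Suc (Suc k)) - 3) = 3 ^ k / 3"
    unfolding * by (simp_all only: power_int_of_nat power_Suc) (simp add: power_int_diff)
qed

lemmas tot_closed_forms =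
  accumulated_Level accumulated_Rise accumulated_fall accumulated_Rise_Dip
  accumulated_Rise_Rise accumulated_Dip_Rise accumulated_Plunge_Rise

lemma tot_pair_formulas:
  assumes "n \<ge> 2"
  shows "real (tot n [1,1]) = (real n - 1) * (3 powi (int n - 2) + 1) / 2"
    and "real (tot n [1,2]) = (real n - 1) * (3 powi (int n - 1) + 1) / 4"
    and "real (tot n [2,1]) = (real n - 1) * (3 powi (int n - 2) - 1) / 4"
proof -
  obtain k where n: "n = Suc (Suc k)" using assms by (metis add_2_eq_Suc le_Suc_ex)
  show "real (tot n [1,1]) = (real n - 1) * (3 powi (int n - 2) + 1) / 2"
    and "real (tot n [1,2]) = (real n - 1) * (3 powi (int n - 1) + 1) / 4"
    and "real (tot n [2,1]) = (real n - 1) * (3 powi (int n - 2) - 1) / 4"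
    unfolding n powi_shift tot_pair_patterns tot_closed_forms by (simp_all add: field_simps)
qed

lemma tot_triple_formulas:
  assumes "n \<ge> 2"
  shows "real (tot n [1,2,1]) = ((real n + 1) * 3 powi (int n - 3) + real n - 3) / 4"
    and "real (tot n [1,2,3]) = (real n - 2) * 3 powi (int n - 3)"
    and "real (tot n [3,1,2]) = ((real n - 5) * 3 powi (int n - 3) + real n - 1) / 4"
proof -
  obtain k where n: "n = Suc (Suc k)" using assms by (metis add_2_eq_Suc le_Suc_ex)
  show "real (tot n [1,2,1]) = ((real n + 1) * 3 powi (int n - 3) + real n - 3) / 4"
    and "real (tot n [1,2,3]) = (real n - 2) * 3 powi (int n - 3)"
    and "real (tot n [3,1,2]) = ((real n - 5) * 3 powi (int n - 3) + real n - 1) / 4"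
    unfolding n powi_shift tot_triple_patterns tot_closed_forms by (simp_all add: field_simps)
qed

text \<open>Except for 212, both sides are given by the same inhomogeneous term. For 212 the terms differ:
  the recursions have different solutions, which agree only at height \<open>0\<close>.\<close>

lemma tot_triple_eq_tot_pair:
  assumes "n \<ge> 2"
  shows "tot n [1,1,1] = tot (n - 1) [1,1]"
    and "t \<in> {[1,1,2], [1,2,2]} \<Longrightarrow> tot n t = tot (n - 1) [1,2]"
    and "t \<in> {[2,1,1], [2,2,1], [2,3,1]} \<Longrightarrow> tot n t = tot (n - 1) [2,1]"
    and "tot n [2,1,2] = tot (n - 1) [2,1]"
proof -
  obtain k where n: "n = Suc (Suc k)" using assms by (metis add_2_eq_Suc le_Suc_ex)
  have "accumulated (\<lambda>n d. of_bool (d > 0) * continuation_count n 1) k 0 =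
      accumulated (\<lambda>n d. real d * continuation_count n 0) k 0"
    unfolding tot_closed_forms by simp
  then have "real (tot n [2,1,2]) = real (tot (n - 1) [2,1])"
    unfolding n diff_Suc_1 tot_pair_patterns tot_triple_patterns .
  then show "tot n [2,1,2] = tot (n - 1) [2,1]" by simp
  have "real (tot n [1,1,1]) = real (tot (n - 1) [1,1])"
    unfolding n diff_Suc_1 tot_pair_patterns tot_triple_patterns ..
  then show "tot n [1,1,1] = tot (n - 1) [1,1]" by simp
  have "real (tot n t) = real (tot (n - 1) [1,2])" if "t \<in> {[1,1,2], [1,2,2]}"
    using that unfolding n diff_Suc_1 by (elim insertE emptyE) (simp_all only: tot_pair_patterns tot_triple_patterns)
  then show "t \<in> {[1,1,2], [1,2,2]} \<Longrightarrow> tot n t = tot (n - 1) [1,2]" by simp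
  have "real (tot n t) = real (tot (n - 1) [2,1])" if "t \<in> {[2,1,1], [2,2,1], [2,3,1]}"
    using that unfolding n diff_Suc_1 by (elim insertE emptyE) (simp_all only: tot_pair_patterns tot_triple_patterns)
  then show "t \<in> {[2,1,1], [2,2,1], [2,3,1]} \<Longrightarrow> tot n t = tot (n - 1) [2,1]" by simp
qed

theorem mainTheorem6:
  fixes x q :: "int poly fract fps"
  assumes "x = fps_X" and "q = fps_const q_var"
  shows
   "(flat_gf [1,1] = x * (1 - (1 + q) * x) / (1 - 2 * (1 + q) * x + q * (2 + q) * x^2) \<and>
     (\<forall>n\<ge>2. real (tot n [1,1]) = (real n - 1) * (3 powi (int n - 2) + 1) / 2)) \<and>
    (flat_gf [1,2] = x * (1 - (1 + q) * x) / (1 - 2 * (1 + q) * x + (1 + q + q^2) * x^2) \<and>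
     (\<forall>n\<ge>2. real (tot n [1,2]) = (real n - 1) * (3 powi (int n - 1) + 1) / 4)) \<and>
    (flat_gf [2,1] = x * (1 - 2 * x) / (1 - 4 * x + (4 - q) * x^2) \<and>
     (\<forall>n\<ge>2. real (tot n [2,1]) = (real n - 1) * (3 powi (int n - 2) - 1) / 4)) \<and>
    (flat_gf [1,1,1] =
       x * (1 + (1 - q) * x) * (1 - (1 + q) * x - (1 - q) * x^2)
         / (1 - 2 * (1 + q) * x - (2 - 4 * q - q^2) * x^2 + 2 * q * (1 - q) * x^3) \<and>
     (\<forall>n\<ge>2. tot n [1,1,1] = tot (n - 1) [1,1])) \<and>
    (\<forall>t \<in> {[1,1,2], [1,2,2]}.
       flat_gf t =
         x * (1 - 2 * x + (1 - q) * x^2)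
           / (1 - 4 * x + (5 - 2 * q) * x^2 - 3 * (1 - q) * x^3 + (1 - q)^2 * x^4) \<and>
       (\<forall>n\<ge>2. tot n t = tot (n - 1) [1,2])) \<and>
    (flat_gf [1,2,1] = x * (1 - 2 * x) / (1 - 4 * x + (4 - q) * x^2 - 2 * (1 - q) * x^3) \<and>
     (\<forall>n\<ge>2. real (tot n [1,2,1]) =
               ((real n + 1) * 3 powi (int n - 3) + real n - 3) / 4)) \<and>
    (flat_gf [1,2,3] =
       x * (1 + (1 - q) * x) * (1 - (1 + q) * x - (1 - q) * x^2)
         / (1 - 2 * (1 + q) * x - (2 - 4 * q - q^2) * x^2 + 2 * (1 - q^2) * x^3
             + (1 - q)^2 * x^4) \<and>
     (\<forall>n\<ge>2. real (tot n [1,2,3]) = (real n - 2) * 3 powi (int n - 3))) \<and>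
    (\<forall>t \<in> {[2,1,1], [2,2,1], [2,3,1]}.
       flat_gf t = x * (1 - 2 * x) / (1 - 4 * x + 3 * x^2 + (1 - q) * x^3) \<and>
       (\<forall>n\<ge>2. tot n t = tot (n - 1) [2,1])) \<and>
    (flat_gf [2,1,2] =
       x * (1 - 3 * x + (3 - q) * x^2 - 2 * (1 - q) * x^3)
         / ((1 - x) * (1 - 4 * x + (4 - q) * x^2 - 2 * (1 - q) * x^3)) \<and>
     (\<forall>n\<ge>2. tot n [2,1,2] = tot (n - 1) [2,1])) \<and>
    (flat_gf [3,1,2] =
       x * (1 - 3 * x + 2 * x^2 + (1 - q) * x^3)
         / ((1 - x) * (1 - 4 * x + 3 * x^2 + (1 - q) * x^3)) \<and>
     (\<forall>n\<ge>2. real (tot n [3,1,2]) =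
               ((real n - 5) * 3 powi (int n - 3) + real n - 1) / 4))"
  by (intro conjI ballI allI impI)
    (rule flat_gf_formulas[OF assms] |
     (rule tot_pair_formulas tot_triple_formulas tot_triple_eq_tot_pair; assumption) |
     (elim insertE emptyE; simp only: flat_gf_formulas[OF assms]))+

end
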